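(* Let $y$ be a real number and let $x$ be a positive real number satisfying $x^x=y$. Then: (a) if $y>e^e$, then $x<\ln(y)$; (b) if $y>e$, then $x>\ln(\ln(y))$.
   Context: Here $\ln$ is the natural logarithm, $e$ is its base, and for $x>0$ the power $x^x$ means $e^{x\ln x}$. *)

theory Defs
  imports Complex_Main
begin

end

theory Submission imports Defs begin

text \<open>
  Taking logarithms turns \<open>x\<^sup>x = y\<close> into \<open>ln y = x * ln x\<close>, so both bounds compare \<open>x\<close> with
  \<open>x * ln x\<close>. In (a), \<open>x * ln x > e\<close> forces \<open>x > e\<close>, so the factor \<open>ln x\<close> exceeds \<open>1\<close>. In (b),
  \<open>x * ln x > 1\<close> forces \<open>x > 1\<close>, and then \<open>ln (ln y) = ln x + ln (ln x) < 2 * ln x < x\<close>.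
\<close>

text \<open>
  The tangent of \<open>ln\<close> at \<open>2\<close> has slope \<open>1/2\<close>, and it lies below the parallel line through the
  origin because \<open>ln 2 < 1\<close>.
\<close>
lemma two_ln_less_self:
  fixes x :: real
  assumes "x > 0"
  shows "2 * ln x < x"
proof -
  have "ln (x / 2) \<le> x / 2 - 1"
    using assms by (intro ln_le_minus_one) simp
  moreover have "ln (x / 2) = ln x - ln 2"
    using assms by (simp add: ln_div)
  ultimately show ?thesis
    using ln_2_less_1 by linarith
qed

lemma less_self_times_ln:
  fixes x :: real
  assumes "x > 0" and "x * ln x > exp 1"
  shows "x < x * ln x"
proof -
  have "ln x > 1"
  proof (rule ccontr)
    assume "\<not> ln x > 1"
    then have ln_le: "ln x \<le> 1" by simp
    then have "x \<le> exp 1"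
      using assms(1) by (metis exp_le_cancel_iff exp_ln)
    moreover have "x * ln x \<le> x * 1"
      using ln_le assms(1) by (intro mult_left_mono) auto
    ultimately show False
      using assms(2) by simp
  qed
  then show ?thesis
    using assms(1) by simp
qed

lemma ln_self_times_ln_less:
  fixes x :: real
  assumes "x > 0" and "ln x > 0"
  shows "ln (x * ln x) < x"
proof -
  have "ln (x * ln x) = ln x + ln (ln x)"
    using assms by (simp add: ln_mult)
  also have "\<dots> < 2 * ln x"
    using ln_less_self[OF assms(2)] by simp
  also have "\<dots> < x"
    using assms(1) by (rule two_ln_less_self)
  finally show ?thesis .
qed

theorem theorem3p1:
  fixes x y :: real
  assumes "x > 0" and "x powr x = y"
  shows "(y > exp 1 powr exp 1 \<longrightarrow> x < ln y) \<and> (y > exp 1 \<longrightarrow> x > ln (ln y))"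
proof (intro conjI impI)
  have y_eq: "y = exp (x * ln x)"
    using assms by (simp add: powr_def)
  then have ln_y: "ln y = x * ln x"
    by simp
  show "x < ln y" if "y > exp 1 powr exp 1"
  proof -
    have "x * ln x > exp 1"
      using that y_eq by (simp add: powr_def)
    then show ?thesis
      using less_self_times_ln assms(1) ln_y by simp
  qed
  show "x > ln (ln y)" if "y > exp 1"
  proof -
    have "x * ln x > 1"
      using that y_eq by simp
    then have "x * ln x > 0"
      by linarith
    then have "ln x > 0"
      using assms(1) zero_less_mult_pos by blast
    then show ?thesis
      using ln_self_times_ln_less assms(1) ln_y by simp
  qed
qed

end
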